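(* Let $(\alpha_m)_{m\in\mathbb{N}}$ be any sequence of positive numbers (an a priori parameter choice) converging monotonically to $0$ as $m\to\infty$. Then there exist a compact operator $K:\ell^2(\mathbb{N})\to\ell^2(\mathbb{N})$, an element $\hat y\in\ell^2(\mathbb{N})$ (in the domain of $K^+$), a discretisation scheme $P_m:\ell^2(\mathbb{N})\to\mathbb{R}^m$, $m\in\mathbb{N}$, and an error model $(\delta_{ij})_{i,j\in\mathbb{N}}$ such that $$\mathbb{E}\left\|R^{(m)}_{\alpha_m}\bar Y^{(m)}_m-K^+\hat y\right\|^2\to\infty\quad\text{as } m\to\infty,$$ where $\bar Y^{(m)}_m=\frac1m\sum_{i=1}^m(Y_{i1},\dots,Y_{im})^T$ with $Y_{ij}=(P_m\hat y)_j+\delta_{ij}$, and $(R^{(m)}_\alpha)_{\alpha>0}$ is the Tikhonov regularisation.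
   Context: A discretisation scheme is a family $P_my=(l_1^{(m)}(y),\dots,l_m^{(m)}(y))^T$ with continuous linear functionals $l_j^{(m)}$ satisfying $\|l_1^{(m)}\|=\dots=\|l_m^{(m)}\|$ and $P_mP_m^*$ bijective for every $m$. An error model is a family $(\delta_{ij})_{i,j\in\mathbb{N}}$ of i.i.d. real random variables with zero mean and finite variance. $K^+$ is the Moore-Penrose inverse of $K$. Tikhonov regularisation: $R_\alpha^{(m)}=\big((P_mK)^*P_mK+\alpha\,\mathrm{Id}\big)^{-1}(P_mK)^*:\mathbb{R}^m\to\ell^2(\mathbb{N})$. The number of repetitions here equals the number $m$ of measurement channels. *)

theory Defs
  imports "HOL-Probability.Probability" "Jordan_Normal_Form.Matrix"
begin

section \<open>The real sequence space \<open>\<ell>\<^sup>2(\<nat>)\<close>\<close>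

typedef ell2 = "{x :: nat \<Rightarrow> real. summable (\<lambda>n. (x n)\<^sup>2)}"
  morphisms coord Abs_ell2
  by (rule exI[of _ "\<lambda>_. 0"]) simp

setup_lifting type_definition_ell2

lemma ell2_summable_mult:
  fixes x y :: "nat \<Rightarrow> real"
  assumes "summable (\<lambda>n. (x n)\<^sup>2)" "summable (\<lambda>n. (y n)\<^sup>2)"
  shows "summable (\<lambda>n. x n * y n)"
proof (rule summable_comparison_test')
  show "summable (\<lambda>n. (x n)\<^sup>2 + (y n)\<^sup>2)"
    using assms by (rule summable_add)
  show "norm (x n * y n) \<le> (x n)\<^sup>2 + (y n)\<^sup>2" for n
  proof -
    have "2 * (\<bar>x n\<bar> * \<bar>y n\<bar>) \<le> (x n)\<^sup>2 + (y n)\<^sup>2"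
      using sum_squares_bound[of "\<bar>x n\<bar>" "\<bar>y n\<bar>"] by simp
    moreover have "0 \<le> \<bar>x n\<bar> * \<bar>y n\<bar>" by simp
    ultimately show ?thesis unfolding real_norm_def abs_mult by linarith
  qed
qed

lemma ell2_summable_add:
  fixes x y :: "nat \<Rightarrow> real"
  assumes "summable (\<lambda>n. (x n)\<^sup>2)" "summable (\<lambda>n. (y n)\<^sup>2)"
  shows "summable (\<lambda>n. (x n + y n)\<^sup>2)"
proof -
  have "summable (\<lambda>n. (x n)\<^sup>2 + (y n)\<^sup>2 + 2 * (x n * y n))"
    by (intro summable_add summable_mult assms ell2_summable_mult)
  then show ?thesis by (simp add: power2_sum mult.assoc)
qed

lemma ell2_summable_scale:
  fixes x :: "nat \<Rightarrow> real"
  assumes "summable (\<lambda>n. (x n)\<^sup>2)"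
  shows "summable (\<lambda>n. (c * x n)\<^sup>2)"
  using summable_mult[OF assms, of "c\<^sup>2"] by (simp add: power_mult_distrib)

lemma ell2_summable_minus:
  fixes x y :: "nat \<Rightarrow> real"
  assumes "summable (\<lambda>n. (x n)\<^sup>2)" "summable (\<lambda>n. (y n)\<^sup>2)"
  shows "summable (\<lambda>n. (x n - y n)\<^sup>2)"
  using ell2_summable_add[OF assms(1), of "\<lambda>n. - y n"] assms(2) by simp

instantiation ell2 :: real_inner
begin

lift_definition zero_ell2 :: ell2 is "\<lambda>_. 0" by simp

lift_definition plus_ell2 :: "ell2 \<Rightarrow> ell2 \<Rightarrow> ell2" is "\<lambda>x y n. x n + y n"
  by (rule ell2_summable_add)

lift_definition minus_ell2 :: "ell2 \<Rightarrow> ell2 \<Rightarrow> ell2" is "\<lambda>x y n. x n - y n"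
  by (rule ell2_summable_minus)

lift_definition uminus_ell2 :: "ell2 \<Rightarrow> ell2" is "\<lambda>x n. - x n" by simp

lift_definition scaleR_ell2 :: "real \<Rightarrow> ell2 \<Rightarrow> ell2" is "\<lambda>c x n. c * x n"
  by (rule ell2_summable_scale)

lift_definition inner_ell2 :: "ell2 \<Rightarrow> ell2 \<Rightarrow> real" is "\<lambda>x y. \<Sum>n. x n * y n" .

definition norm_ell2 :: "ell2 \<Rightarrow> real"
  where "norm_ell2 x = sqrt (inner x x)"

definition dist_ell2 :: "ell2 \<Rightarrow> ell2 \<Rightarrow> real"
  where "dist_ell2 x y = norm (x - y)"

definition sgn_ell2 :: "ell2 \<Rightarrow> ell2"
  where "sgn_ell2 x = inverse (norm x) *\<^sub>R x"

definition uniformity_ell2 :: "(ell2 \<times> ell2) filter"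
  where "uniformity_ell2 = (INF e\<in>{0 <..}. principal {(x, y). dist x y < e})"

definition open_ell2 :: "ell2 set \<Rightarrow> bool"
  where "open_ell2 U = (\<forall>x\<in>U. \<forall>\<^sub>F (x', y) in uniformity. x' = x \<longrightarrow> y \<in> U)"

instance
proof
  fix x y z :: ell2 and a b :: real and U :: "ell2 set"
  show "x + y + z = x + (y + z)" by transfer (simp add: add.assoc)
  show "x + y = y + x" by transfer (simp add: add.commute)
  show "0 + x = x" by transfer simp
  show "- x + x = 0" by transfer simp
  show "x - y = x + - y" by transfer simp
  show "a *\<^sub>R (x + y) = a *\<^sub>R x + a *\<^sub>R y" by transfer (simp add: distrib_left)
  show "(a + b) *\<^sub>R x = a *\<^sub>R x + b *\<^sub>R x" by transfer (simp add: distrib_right)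
  show "a *\<^sub>R b *\<^sub>R x = (a * b) *\<^sub>R x" by transfer (simp add: mult.assoc)
  show "1 *\<^sub>R x = x" by transfer simp
  show "sgn x = inverse (norm x) *\<^sub>R x" by (rule sgn_ell2_def)
  show "dist x y = norm (x - y)" by (rule dist_ell2_def)
  show "uniformity = (INF e\<in>{0 <..}. principal {(x, y). dist (x::ell2) y < e})"
    by (rule uniformity_ell2_def)
  show "open U = (\<forall>x\<in>U. \<forall>\<^sub>F (x', y) in uniformity. x' = x \<longrightarrow> y \<in> U)"
    by (rule open_ell2_def)
  show "inner x y = inner y x" by transfer (simp add: mult.commute)
  show "inner (x + y) z = inner x z + inner y z"
    by transfer (simp add: distrib_right suminf_add ell2_summable_mult)
  show "inner (a *\<^sub>R x) y = a * inner x y"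
    by transfer (simp add: mult.assoc suminf_mult ell2_summable_mult)
  show "0 \<le> inner x x"
    by transfer (rule suminf_nonneg, auto intro: ell2_summable_mult)
  show "inner x x = 0 \<longleftrightarrow> x = 0"
  proof transfer
    fix x :: "nat \<Rightarrow> real"
    assume "summable (\<lambda>n. (x n)\<^sup>2)"
    then show "(\<Sum>n. x n * x n) = 0 \<longleftrightarrow> x = (\<lambda>_. 0)"
      using suminf_eq_zero_iff[of "\<lambda>n. (x n)\<^sup>2"] by (auto simp: power2_eq_square)
  qed
  show "norm x = sqrt (inner x x)" by (rule norm_ell2_def)
qed

end

lemma norm_ell2_sq: "(norm x)\<^sup>2 = (\<Sum>n. (coord x n)\<^sup>2)"
  unfolding power2_norm_eq_inner inner_ell2.rep_eq by (simp add: power2_eq_square)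

lemma summable_coord_sq: "summable (\<lambda>n. (coord x n)\<^sup>2)"
  using coord[of x] by simp

lemma abs_coord_le_norm: "\<bar>coord x n\<bar> \<le> norm x"
proof (rule power2_le_imp_le)
  have "(coord x n)\<^sup>2 \<le> (\<Sum>n. (coord x n)\<^sup>2)"
    using sum_le_suminf[OF summable_coord_sq, of "{n}" x] by simp
  then show "\<bar>coord x n\<bar>\<^sup>2 \<le> (norm x)\<^sup>2" by (simp add: norm_ell2_sq)
qed simp

instance ell2 :: banach
proof
  fix X :: "nat \<Rightarrow> ell2"
  assume X: "Cauchy X"
  have "Cauchy (\<lambda>k. coord (X k) n)" for n
  proof (rule metric_CauchyI)
    fix e :: real assume "0 < e"
    then obtain N where N: "\<And>k l. k \<ge> N \<Longrightarrow> l \<ge> N \<Longrightarrow> dist (X k) (X l) < e"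
      using X unfolding Cauchy_def by metis
    have "dist (coord (X k) n) (coord (X l) n) < e" if "k \<ge> N" "l \<ge> N" for k l
      using abs_coord_le_norm[of "X k - X l" n] N[OF that]
      by (simp add: dist_norm minus_ell2.rep_eq)
    then show "\<exists>N. \<forall>k\<ge>N. \<forall>l\<ge>N. dist (coord (X k) n) (coord (X l) n) < e" by blast
  qed
  then have "\<exists>L. (\<lambda>k. coord (X k) n) \<longlonglongrightarrow> L" for n
    using Cauchy_convergent_iff convergent_def by blast
  then obtain L where L: "\<And>n. (\<lambda>k. coord (X k) n) \<longlonglongrightarrow> L n" by metis
  have tail: "summable (\<lambda>n. (coord (X k) n - L n)\<^sup>2)"
      "(\<Sum>n. (coord (X k) n - L n)\<^sup>2) \<le> e\<^sup>2"
    if bd: "\<And>l. l \<ge> N \<Longrightarrow> norm (X k - X l) \<le> e" for k N e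
  proof -
    have part: "(\<Sum>n<j. (coord (X k) n - L n)\<^sup>2) \<le> e\<^sup>2" for j
    proof (rule LIMSEQ_le_const2)
      show "(\<lambda>l. \<Sum>n<j. (coord (X k) n - coord (X l) n)\<^sup>2)
          \<longlonglongrightarrow> (\<Sum>n<j. (coord (X k) n - L n)\<^sup>2)"
        by (intro tendsto_intros L)
      have "(\<Sum>n<j. (coord (X k) n - coord (X l) n)\<^sup>2) \<le> e\<^sup>2" if "l \<ge> N" for l
      proof -
        have "(\<Sum>n<j. (coord (X k) n - coord (X l) n)\<^sup>2) \<le> (norm (X k - X l))\<^sup>2"
          using sum_le_suminf[OF summable_coord_sq, of "{..<j}" "X k - X l"]
          by (simp add: norm_ell2_sq minus_ell2.rep_eq)
        also have "\<dots> \<le> e\<^sup>2" using bd[OF that] by (intro power_mono) auto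
        finally show ?thesis .
      qed
      then show "\<exists>N. \<forall>l\<ge>N. (\<Sum>n<j. (coord (X k) n - coord (X l) n)\<^sup>2) \<le> e\<^sup>2" by blast
    qed
    show s: "summable (\<lambda>n. (coord (X k) n - L n)\<^sup>2)"
      by (rule summableI_nonneg_bounded[of _ "e\<^sup>2"]) (auto intro: part)
    show "(\<Sum>n. (coord (X k) n - L n)\<^sup>2) \<le> e\<^sup>2"
      by (rule suminf_le_const[OF s part])
  qed
  have ev: "\<exists>N. \<forall>k\<ge>N. \<forall>l\<ge>N. norm (X k - X l) \<le> e" if "0 < e" for e
    using X that unfolding Cauchy_def dist_norm by (meson less_imp_le)
  obtain N1 where "\<forall>k\<ge>N1. \<forall>l\<ge>N1. norm (X k - X l) \<le> 1" using ev[of 1] by auto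
  then have "summable (\<lambda>n. (coord (X N1) n - L n)\<^sup>2)" by (intro tail(1)[of N1]) auto
  from ell2_summable_minus[OF summable_coord_sq this, of "X N1"]
  have sL: "summable (\<lambda>n. (L n)\<^sup>2)" by simp
  have cL: "coord (Abs_ell2 L) = L" using sL by (simp add: Abs_ell2_inverse)
  have "X \<longlonglongrightarrow> Abs_ell2 L"
  proof (rule metric_LIMSEQ_I)
    fix r :: real assume r: "0 < r"
    obtain N where N: "\<forall>k\<ge>N. \<forall>l\<ge>N. norm (X k - X l) \<le> r / 2" using ev[of "r / 2"] r by auto
    have "dist (X k) (Abs_ell2 L) < r" if "k \<ge> N" for k
    proof -
      have "(norm (X k - Abs_ell2 L))\<^sup>2 \<le> (r / 2)\<^sup>2"
        using tail(2)[of N k "r / 2"] N that by (simp add: norm_ell2_sq minus_ell2.rep_eq cL)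
      then have "norm (X k - Abs_ell2 L) \<le> r / 2" by (rule power2_le_imp_le) (use r in simp)
      then show ?thesis using r by (simp add: dist_norm)
    qed
    then show "\<exists>N. \<forall>k\<ge>N. dist (X k) (Abs_ell2 L) < r" by blast
  qed
  then show "convergent X" by (auto simp: convergent_def)
qed

section \<open>Operators\<close>

definition compact_operator :: "('a::real_normed_vector \<Rightarrow> 'b::real_normed_vector) \<Rightarrow> bool" where
  "compact_operator K \<longleftrightarrow>
     bounded_linear K \<and> (\<forall>B. bounded B \<longrightarrow> compact (closure (K ` B)))"

text \<open>The Moore-Penrose inverse is the linear operator on \<open>range K + (range K)\<^sup>\<bottom>\<close> that extends
  the inverse of \<open>K\<close> restricted to \<open>(ker K)\<^sup>\<bottom>\<close> and vanishes on \<open>(range K)\<^sup>\<bottom>\<close>: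
  if \<open>y = K x + z\<close> with \<open>x\<close> orthogonal to the kernel and \<open>z\<close> orthogonal to the range, then
  \<open>K\<^sup>+ y = x\<close>. Its value is unspecified outside this domain.\<close>

definition mp_domain :: "('a::real_inner \<Rightarrow> 'b::real_inner) \<Rightarrow> 'b set" where
  "mp_domain K = {K x + z | x z. z \<in> orthogonal_comp (range K)}"

definition mp_inverse :: "('a::real_inner \<Rightarrow> 'b::real_inner) \<Rightarrow> 'b \<Rightarrow> 'a" where
  "mp_inverse K y =
     (THE x. x \<in> orthogonal_comp {u. K u = 0} \<and> y - K x \<in> orthogonal_comp (range K))"

text \<open>Elements of \<open>\<real>\<^sup>m\<close> are the vectors in \<^term>\<open>carrier_vec m\<close>, with components indexed
  by \<open>0, \<dots>, m - 1\<close> and the Euclidean inner product \<^const>\<open>scalar_prod\<close>. Since their type is not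
  an inner product space, the library's \<^const>\<open>adjoint\<close> does not apply to maps into \<open>\<real>\<^sup>m\<close>.
  On a Hilbert space, for a bounded linear \<open>A\<close> into \<open>\<real>\<^sup>m\<close> and \<open>v\<close> in \<open>\<real>\<^sup>m\<close>, the element described here exists
  and is unique by the Riesz representation theorem.\<close>

definition vec_adjoint :: "('a::real_inner \<Rightarrow> real Matrix.vec) \<Rightarrow> real Matrix.vec \<Rightarrow> 'a" where
  "vec_adjoint A v = (THE z. \<forall>x. inner x z = scalar_prod (A x) v)"

text \<open>For \<open>\<alpha> > 0\<close> and \<open>A\<close> as above, the map that is inverted below is a bijection.\<close>

definition tikhonov :: "('a::real_inner \<Rightarrow> real Matrix.vec) \<Rightarrow> real \<Rightarrow> real Matrix.vec \<Rightarrow> 'a" where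
  "tikhonov A \<alpha> v = inv_into UNIV (\<lambda>x. vec_adjoint A (A x) + \<alpha> *\<^sub>R x) (vec_adjoint A v)"

section \<open>Discretisation and measurements\<close>

text \<open>The functional \<open>l\<^sub>j\<^sup>(\<^sup>m\<^sup>)\<close> is the component \<open>\<lambda>y. vec_index (P m y) (j - 1)\<close>.\<close>

definition discretisation_scheme :: "(nat \<Rightarrow> 'a::real_inner \<Rightarrow> real Matrix.vec) \<Rightarrow> bool" where
  "discretisation_scheme P \<longleftrightarrow>
     (\<forall>m y. P m y \<in> carrier_vec m) \<and>
     (\<forall>m. \<forall>j<m. bounded_linear (\<lambda>y. vec_index (P m y) j)) \<and>
     (\<forall>m. \<forall>i<m. \<forall>j<m. onorm (\<lambda>y. vec_index (P m y) i) = onorm (\<lambda>y. vec_index (P m y) j)) \<and>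
     (\<forall>m. bij_betw (\<lambda>v. P m (vec_adjoint (P m) v)) (carrier_vec m) (carrier_vec m))"

definition error_model :: "'w measure \<Rightarrow> (nat \<Rightarrow> nat \<Rightarrow> 'w \<Rightarrow> real) \<Rightarrow> bool" where
  "error_model M \<delta> \<longleftrightarrow>
     prob_space M \<and>
     prob_space.indep_vars M (\<lambda>_. borel) (\<lambda>(i, j). \<delta> i j) UNIV \<and>
     (\<forall>i j i' j'. distr M borel (\<delta> i j) = distr M borel (\<delta> i' j')) \<and>
     (\<forall>i j. integrable M (\<delta> i j) \<and> (LINT \<omega>|M. \<delta> i j \<omega>) = 0 \<and>
            integrable M (\<lambda>\<omega>. (\<delta> i j \<omega>)\<^sup>2))"

text \<open>\<open>measurement P y \<delta> m i j \<omega>\<close> is \<open>Y\<^sub>i\<^sub>j\<close>, the \<open>i\<close>-th repetition on the \<open>j\<close>-th of \<open>m\<close> channels,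
  and \<open>averaged_data P y \<delta> m n \<omega>\<close> is the mean over \<open>n\<close> repetitions. Both indices count from 0.\<close>

definition measurement ::
  "(nat \<Rightarrow> 'a \<Rightarrow> real Matrix.vec) \<Rightarrow> 'a \<Rightarrow> (nat \<Rightarrow> nat \<Rightarrow> 'w \<Rightarrow> real) \<Rightarrow>
   nat \<Rightarrow> nat \<Rightarrow> nat \<Rightarrow> 'w \<Rightarrow> real" where
  "measurement P y \<delta> m i j \<omega> = vec_index (P m y) j + \<delta> i j \<omega>"

definition averaged_data ::
  "(nat \<Rightarrow> 'a \<Rightarrow> real Matrix.vec) \<Rightarrow> 'a \<Rightarrow> (nat \<Rightarrow> nat \<Rightarrow> 'w \<Rightarrow> real) \<Rightarrow>
   nat \<Rightarrow> nat \<Rightarrow> 'w \<Rightarrow> real Matrix.vec" where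
  "averaged_data P y \<delta> m n \<omega> =
     Matrix.vec m (\<lambda>j. (1 / real n) * (\<Sum>i<n. measurement P y \<delta> m i j \<omega>))"

end

theory Submission
  imports Defs
begin

text \<open>Take the exact datum \<open>0\<close>, standard normal errors, the first \<open>m\<close> coordinates as channels and the
  diagonal operator with singular values \<open>sqrt (\<alpha> j)\<close>. Tikhonov regularisation then filters the
  noise channel by channel, and the expected squared error is
  \<open>1 / m * (\<Sum>j<m. \<alpha> j / (\<alpha> j + \<alpha> m)\<^sup>2)\<close>. As \<open>\<alpha> m \<le> \<alpha> j\<close> for \<open>j < m\<close>, it dominates
  the Cesaro means of \<open>1 / (4 * \<alpha> j)\<close>, which diverge.\<close>

section \<open>Unit vectors and diagonal operators\<close>

lift_definition unit_ell2 :: "nat \<Rightarrow> ell2" is "\<lambda>j n. if n = j then 1 else 0"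
  subgoal for j by (rule summable_finite[of "{j}"]) auto
  done

lemma coord_sum: "coord (\<Sum>i\<in>A. f i) n = (\<Sum>i\<in>A. coord (f i) n)"
  by (induction A rule: infinite_finite_induct) (auto simp: zero_ell2.rep_eq plus_ell2.rep_eq)

lemma coord_unit_sum:
  "coord (\<Sum>j<m. c j *\<^sub>R unit_ell2 j) n = (if n < m then c n else 0)"
  by (simp add: coord_sum scaleR_ell2.rep_eq unit_ell2.rep_eq if_distrib cong: if_cong)

lemma inner_unit_ell2: "inner x (unit_ell2 j) = coord x j"
proof -
  have "(\<Sum>n. coord x n * (if n = j then 1 else 0)) = (\<Sum>n\<in>{j}. coord x n * (if n = j then 1 else 0))"
    by (rule suminf_finite) auto
  then show ?thesis by (simp add: inner_ell2.rep_eq unit_ell2.rep_eq)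
qed

lemma inner_unit_sum: "inner x (\<Sum>j<m. c j *\<^sub>R unit_ell2 j) = (\<Sum>j<m. c j * coord x j)"
  by (simp add: inner_sum_right inner_unit_ell2)

lemma norm_unit_sum_sq: "(norm (\<Sum>j<m. c j *\<^sub>R unit_ell2 j))\<^sup>2 = (\<Sum>j<m. (c j)\<^sup>2)"
  unfolding power2_norm_eq_inner inner_unit_sum by (simp add: coord_unit_sum power2_eq_square)

lemma ell2_eqI: "(\<And>n. coord x n = coord y n) \<Longrightarrow> x = y"
  by (simp add: coord_inject[symmetric] fun_eq_iff)

lemma bounded_linear_coord: "bounded_linear (\<lambda>x. coord x n)"
  by (rule bounded_linear_intro[where K = 1])
    (auto simp: plus_ell2.rep_eq scaleR_ell2.rep_eq abs_coord_le_norm)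

text \<open>The bound 1 is attained at \<open>unit_ell2 n\<close>. The common value gives the equal
  norms of the functionals that a discretisation scheme requires.\<close>

lemma onorm_coord: "onorm (\<lambda>x. coord x n) = 1"
proof (rule antisym)
  show "onorm (\<lambda>x. coord x n) \<le> 1"
    by (rule onorm_bound) (auto simp: abs_coord_le_norm)
  have "norm (unit_ell2 n) = 1"
    by (simp add: norm_eq_sqrt_inner inner_unit_ell2 unit_ell2.rep_eq)
  then show "1 \<le> onorm (\<lambda>x. coord x n)"
    using le_onorm[OF bounded_linear_coord, of "unit_ell2 n" n] by (simp add: unit_ell2.rep_eq)
qed

lemma norm_ell2_mono:
  assumes "\<And>n. \<bar>coord x n\<bar> \<le> \<bar>coord y n\<bar>"
  shows "norm x \<le> norm y"
proof (rule power2_le_imp_le)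
  show "(norm x)\<^sup>2 \<le> (norm y)\<^sup>2"
    unfolding norm_ell2_sq by (intro suminf_le summable_coord_sq) (use assms abs_le_square_iff in blast)
qed simp

text \<open>\<open>Abs_ell2\<close> is meaningful only on square summable sequences. A bounded
  \<open>k\<close> guarantees this for every \<open>x\<close>, hence the hypothesis
  \<open>Bseq k\<close> in the facts about this operator.\<close>

definition diag_ell2 :: "(nat \<Rightarrow> real) \<Rightarrow> ell2 \<Rightarrow> ell2" where
  "diag_ell2 k x = Abs_ell2 (\<lambda>n. k n * coord x n)"

lemma coord_diag_ell2:
  assumes "Bseq k"
  shows "coord (diag_ell2 k x) n = k n * coord x n"
proof -
  obtain B where B: "\<And>n. \<bar>k n\<bar> \<le> B" using assms by (auto simp: Bseq_def)
  have "summable (\<lambda>n. (k n * coord x n)\<^sup>2)"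
  proof (rule summable_comparison_test')
    show "summable (\<lambda>n. B\<^sup>2 * (coord x n)\<^sup>2)"
      by (intro summable_mult summable_coord_sq)
    show "norm ((k n * coord x n)\<^sup>2) \<le> B\<^sup>2 * (coord x n)\<^sup>2" for n
      using power_mono[OF B[of n], of 2] by (simp add: power_mult_distrib mult_right_mono)
  qed
  then show ?thesis by (simp add: diag_ell2_def Abs_ell2_inverse)
qed

section \<open>Boundedness and compactness of diagonal operators\<close>

lemma bounded_linear_diag_ell2:
  assumes "Bseq k"
  shows "bounded_linear (diag_ell2 k)"
proof -
  obtain B where B: "\<And>n. \<bar>k n\<bar> \<le> B" using assms by (auto simp: Bseq_def)
  show ?thesis
  proof (rule bounded_linear_intro)
    show "norm (diag_ell2 k x) \<le> norm x * B" for x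
    proof -
      have "0 \<le> B" using B[of 0] by simp
      have "norm (diag_ell2 k x) \<le> norm (B *\<^sub>R x)"
        by (rule norm_ell2_mono)
          (use B \<open>0 \<le> B\<close> in \<open>auto simp: coord_diag_ell2[OF assms] scaleR_ell2.rep_eq abs_mult mult_right_mono\<close>)
      then show ?thesis using \<open>0 \<le> B\<close> by (simp add: mult.commute)
    qed
  qed (auto intro!: ell2_eqI simp: coord_diag_ell2[OF assms] plus_ell2.rep_eq scaleR_ell2.rep_eq algebra_simps)
qed

text \<open>By induction on \<open>m\<close>, each box is the Minkowski sum of the previous box and
  a segment along the new axis. These finite-dimensional boxes serve as approximants in the
  compactness proof for diagonal operators.\<close>

lemma compact_unit_sums:
  "compact {(\<Sum>j<m. c j *\<^sub>R unit_ell2 j) | c. \<forall>j. \<bar>c j\<bar> \<le> R}" (is "compact (?S m)")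
proof (cases "0 \<le> R")
  case R: True
  show ?thesis
  proof (induction m)
    case 0
    \<comment> \<open>The constraint ranges over all \<open>j\<close>, even for an empty sum, so an
      admissible \<open>c\<close> must be exhibited; this is where \<open>0 \<le> R\<close>
      enters.\<close>
    have "?S 0 = {0}" using R by (auto intro!: exI[of _ "\<lambda>_. 0"])
    then show ?case by simp
  next
    case (Suc m)
    let ?T = "(\<lambda>c. c *\<^sub>R unit_ell2 m) ` {-R..R}"
    have "?S (Suc m) = {x + y | x y. x \<in> ?S m \<and> y \<in> ?T}"
    proof (intro equalityI subsetI)
      fix z assume "z \<in> ?S (Suc m)"
      then obtain c where c: "z = (\<Sum>j<m. c j *\<^sub>R unit_ell2 j) + c m *\<^sub>R unit_ell2 m" "\<forall>j. \<bar>c j\<bar> \<le> R"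
        by auto
      then have "c m \<in> {-R..R}" by (simp add: abs_le_iff minus_le_iff)
      with c show "z \<in> {x + y | x y. x \<in> ?S m \<and> y \<in> ?T}" by blast
    next
      fix z assume "z \<in> {x + y | x y. x \<in> ?S m \<and> y \<in> ?T}"
      then obtain c d where "z = (\<Sum>j<m. c j *\<^sub>R unit_ell2 j) + d *\<^sub>R unit_ell2 m"
          "\<forall>j. \<bar>c j\<bar> \<le> R" "d \<in> {-R..R}"
        by auto
      then show "z \<in> ?S (Suc m)"
        \<comment> \<open>Overwriting \<open>c\<close> at \<open>m\<close> leaves the sum over
          \<open>j < m\<close> unchanged and keeps the bound for all indices.\<close>
        by (auto intro!: exI[of _ "c(m := d)"])
    qed
    moreover have "compact ?T"
      by (intro compact_continuous_image continuous_intros) simp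
    ultimately show ?case using compact_sums[OF Suc] by simp
  qed
next
  case False
  then have "?S m = {}" by force
  then show ?thesis by (simp only: compact_empty)
qed

text \<open>A set lying arbitrarily close to compact sets inherits their finite nets and is totally
  bounded; completeness of the space then gives compactness of the closure.\<close>

lemma compact_closure_approx:
  fixes S :: "'a::complete_space set"
  assumes "\<And>e. 0 < e \<Longrightarrow> \<exists>C. compact C \<and> (\<forall>x\<in>S. \<exists>y\<in>C. dist x y < e)"
  shows "compact (closure S)"
  unfolding compact_eq_totally_bounded
proof (intro conjI allI impI)
  show "Topological_Spaces.complete (closure S)" by (simp add: complete_eq_closed)
  fix e :: real assume e: "0 < e"
  \<comment> \<open>The chain from the closure to \<open>S\<close>, then to \<open>C\<close>, then
    to the net of \<open>C\<close> has three links, each below \<open>e / 4\<close>.\<close>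
  then obtain C where C: "compact C" "\<And>x. x \<in> S \<Longrightarrow> \<exists>y\<in>C. dist x y < e / 4"
    using assms[of "e / 4"] by auto
  obtain k where k: "finite k" "C \<subseteq> (\<Union>x\<in>k. ball x (e / 4))"
    using C(1) e unfolding compact_eq_totally_bounded by (meson zero_less_divide_iff zero_less_numeral)
  have "closure S \<subseteq> (\<Union>x\<in>k. ball x e)"
  proof
    fix x assume "x \<in> closure S"
    then obtain y where y: "y \<in> S" "dist y x < e / 4"
      using e by (meson closure_approachable zero_less_divide_iff zero_less_numeral)
    obtain z where z: "z \<in> C" "dist y z < e / 4" using C(2) y by blast
    obtain w where w: "w \<in> k" "dist w z < e / 4" using k z by auto
    have "dist w x \<le> dist w z + dist y z + dist y x"
      by (smt (verit) dist_commute dist_triangle)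
    with y z w e show "x \<in> (\<Union>x\<in>k. ball x e)" by (auto intro!: bexI[of _ w])
  qed
  with k(1) show "\<exists>k. finite k \<and> closure S \<subseteq> (\<Union>x\<in>k. ball x e)" by blast
qed

text \<open>Truncation to the first \<open>m\<close> coordinates approximates the operator uniformly
  on bounded sets, since the remaining weights are small.\<close>

lemma compact_operator_diag_ell2:
  assumes "k \<longlonglongrightarrow> 0"
  shows "compact_operator (diag_ell2 k)"
  unfolding compact_operator_def
proof (intro conjI allI impI)
  have k: "Bseq k" using assms convergentI convergent_imp_Bseq by blast
  then show "bounded_linear (diag_ell2 k)" by (rule bounded_linear_diag_ell2)
  fix B :: "ell2 set" assume "bounded B"
  then obtain R where R: "0 < R" "\<And>x. x \<in> B \<Longrightarrow> norm x \<le> R" by (auto simp: bounded_pos)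
  obtain L where L: "\<And>n. \<bar>k n\<bar> \<le> L" using k by (auto simp: Bseq_def)
  show "compact (closure (diag_ell2 k ` B))"
  proof (rule compact_closure_approx)
    fix e :: real assume e: "0 < e"
    \<comment> \<open>With this threshold the truncation error is at most
      \<open>d * R = e / 2\<close>, strictly below \<open>e\<close>.\<close>
    define d where "d = e / (2 * R)"
    have "0 < d" using e R by (simp add: d_def)
    then obtain m where m: "\<And>n. n \<ge> m \<Longrightarrow> \<bar>k n\<bar> < d"
      using LIMSEQ_D[OF assms] by auto
    let ?C = "{(\<Sum>j<m. c j *\<^sub>R unit_ell2 j) | c. \<forall>j. \<bar>c j\<bar> \<le> L * R}"
    have "\<exists>y\<in>?C. dist (diag_ell2 k x) y < e" if x: "x \<in> B" for x
    proof
      let ?y = "\<Sum>j<m. (k j * coord x j) *\<^sub>R unit_ell2 j"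
      have "\<forall>j. \<bar>k j * coord x j\<bar> \<le> L * R"
        unfolding abs_mult using L[of 0]
        by (intro mult_mono L order_trans[OF abs_coord_le_norm R(2)[OF x]] allI) auto
      then show "?y \<in> ?C" by (auto intro!: exI[of _ "\<lambda>j. k j * coord x j"])
      \<comment> \<open>The coordinates below \<open>m\<close> cancel; beyond them the weights are
        below \<open>d\<close> in absolute value.\<close>
      have "norm (diag_ell2 k x - ?y) \<le> norm (d *\<^sub>R x)"
        by (rule norm_ell2_mono)
          (use m[THEN less_imp_le] \<open>0 < d\<close> in \<open>auto simp: coord_diag_ell2[OF k] minus_ell2.rep_eq coord_unit_sum
            scaleR_ell2.rep_eq abs_mult not_less intro!: mult_right_mono\<close>)
      also have "\<dots> \<le> d * R" using R(2)[OF x] \<open>0 < d\<close> by simp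
      also have "\<dots> < e" using e R by (simp add: d_def)
      finally show "dist (diag_ell2 k x) ?y < e" by (simp add: dist_norm)
    qed
    then show "\<exists>C. compact C \<and> (\<forall>x\<in>diag_ell2 k ` B. \<exists>y\<in>C. dist x y < e)"
      using compact_unit_sums[of m "L * R"] by blast
  qed
qed

text \<open>Any candidate \<open>x\<close> has \<open>- K x\<close> orthogonal to the range, in
  particular to \<open>K x\<close> itself. So \<open>K x = 0\<close>, and injectivity gives
  \<open>x = 0\<close>.\<close>

lemma mp_inverse_zero:
  assumes "linear K" "inj K"
  shows "mp_inverse K 0 = 0"
  unfolding mp_inverse_def
proof (rule the_equality)
  have K0: "K 0 = 0" using assms(1) by (rule linear_0)
  show "0 \<in> orthogonal_comp {u. K u = 0} \<and> 0 - K 0 \<in> orthogonal_comp (range K)"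
    by (simp add: K0 subspace_0[OF subspace_orthogonal_comp])
  fix x assume "x \<in> orthogonal_comp {u. K u = 0} \<and> 0 - K x \<in> orthogonal_comp (range K)"
  then have "inner (K x) (0 - K x) = 0"
    unfolding orthogonal_comp_def Linear_Algebra.orthogonal_def by blast
  then have "K x = K 0" by (simp add: K0)
  with assms(2) show "x = 0" by (simp add: inj_eq)
qed

section \<open>Sampling the first coordinates\<close>

text \<open>Two representing elements differ by a vector orthogonal to everything, itself included.
  The description operator can thus be evaluated by exhibiting a candidate.\<close>

lemma vec_adjoint_eqI:
  fixes A :: "'a::real_inner \<Rightarrow> real Matrix.vec"
  assumes "\<And>x. inner x z = scalar_prod (A x) v"
  shows "vec_adjoint A v = z"
  unfolding vec_adjoint_def
proof (rule the_equality)
  fix w assume "\<forall>x. inner x w = scalar_prod (A x) v"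
  then have "inner (w - z) (w - z) = 0" using assms by (simp add: inner_diff_right)
  then show "w = z" by simp
qed (use assms in blast)

text \<open>The weights \<open>k\<close> let one formula cover both plain sampling (all weights 1)
  and sampling after the diagonal operator.\<close>

lemma vec_adjoint_weighted:
  assumes "v \<in> carrier_vec m"
  shows "vec_adjoint (\<lambda>x. Matrix.vec m (\<lambda>j. k j * coord x j)) v
    = (\<Sum>j<m. (k j * vec_index v j) *\<^sub>R unit_ell2 j)"
  using assms
  by (intro vec_adjoint_eqI)
    (auto simp: inner_unit_sum scalar_prod_def atLeast0LessThan ac_simps intro!: sum.cong)

text \<open>The regularised normal operator is diagonal, with entry \<open>(k n)\<^sup>2 + a\<close>
  for \<open>n < m\<close> and \<open>a\<close> beyond. All entries are positive, so it is
  injective, and \<open>?z\<close> is the preimage that \<open>inv_into\<close> selects.\<close>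

lemma tikhonov_weighted:
  assumes v: "v \<in> carrier_vec m" and a: "0 < a"
  shows "tikhonov (\<lambda>x. Matrix.vec m (\<lambda>j. k j * coord x j)) a v
    = (\<Sum>j<m. (k j / ((k j)\<^sup>2 + a) * vec_index v j) *\<^sub>R unit_ell2 j)" (is "_ = ?z")
proof -
  let ?A = "\<lambda>x. Matrix.vec m (\<lambda>j. k j * coord x j)"
  let ?F = "\<lambda>x. vec_adjoint ?A (?A x) + a *\<^sub>R x"
  have pos: "0 < (k j)\<^sup>2 + a" for j using a by (intro add_nonneg_pos) auto
  have F: "coord (?F x) n = (if n < m then (k n)\<^sup>2 + a else a) * coord x n" for x n
    by (simp add: vec_adjoint_weighted plus_ell2.rep_eq scaleR_ell2.rep_eq coord_unit_sum
      power2_eq_square algebra_simps)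
  have "inj ?F"
  proof (rule injI)
    fix x y assume "?F x = ?F y"
    then have eq: "(if n < m then (k n)\<^sup>2 + a else a) * coord x n
        = (if n < m then (k n)\<^sup>2 + a else a) * coord y n" for n
      unfolding F[symmetric] by (rule arg_cong)
    have "(if n < m then (k n)\<^sup>2 + a else a) \<noteq> 0" for n
      using a pos[of n] by simp
    then have "coord x n = coord y n" for n using eq[of n] mult_left_cancel by blast
    then show "x = y" by (rule ell2_eqI)
  qed
  moreover have "?F ?z = vec_adjoint ?A v"
  proof (rule ell2_eqI)
    fix n
    have "(k n)\<^sup>2 + a \<noteq> 0" using pos[of n] by simp
    then have "coord (?F ?z) n = (if n < m then k n * vec_index v n else 0)"
      by (subst F) (simp add: coord_unit_sum)
    then show "coord (?F ?z) n = coord (vec_adjoint ?A v) n"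
      by (simp only: vec_adjoint_weighted[OF v] coord_unit_sum)
  qed
  ultimately have "inv_into UNIV ?F (vec_adjoint ?A v) = ?z"
    by (intro inv_into_f_eq) auto
  then show ?thesis unfolding tikhonov_def .
qed

definition sample_ell2 :: "nat \<Rightarrow> ell2 \<Rightarrow> real Matrix.vec" where
  "sample_ell2 m x = Matrix.vec m (coord x)"

lemma discretisation_scheme_sample_ell2: "discretisation_scheme sample_ell2"
proof -
  \<comment> \<open>The explicit factor 1 matches the pattern of
    \<open>vec_adjoint_weighted\<close>, which then shows that sampling after its adjoint is the
    identity.\<close>
  have P: "sample_ell2 m = (\<lambda>x. Matrix.vec m (\<lambda>j. 1 * coord x j))" for m
    by (simp add: sample_ell2_def fun_eq_iff)
  have "sample_ell2 m (vec_adjoint (sample_ell2 m) v) = v" if "v \<in> carrier_vec m" for m v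
    using that by (intro eq_vecI) (simp_all only: P vec_adjoint_weighted coord_unit_sum carrier_vecD, auto)
  then have "bij_betw (\<lambda>v. sample_ell2 m (vec_adjoint (sample_ell2 m) v)) (carrier_vec m) (carrier_vec m)" for m
    by (subst bij_betw_cong[where g = id]) auto
  then show ?thesis
    unfolding discretisation_scheme_def
    by (auto simp: sample_ell2_def bounded_linear_coord onorm_coord)
qed

section \<open>Gaussian errors\<close>

text \<open>Bienayme's identity: after expanding the square, independence factors each off-diagonal
  expectation into a product of zero means.\<close>

lemma (in prob_space) expectation_square_sum_indep:
  fixes X :: "'i \<Rightarrow> 'a \<Rightarrow> real"
  assumes I: "finite I" and indep: "indep_vars (\<lambda>_. borel) X I"
    and int: "\<And>i. i \<in> I \<Longrightarrow> integrable M (X i)" "\<And>i. i \<in> I \<Longrightarrow> integrable M (\<lambda>\<omega>. (X i \<omega>)\<^sup>2)"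
    and mean: "\<And>i. i \<in> I \<Longrightarrow> expectation (X i) = 0"
  shows "integrable M (\<lambda>\<omega>. (\<Sum>i\<in>I. X i \<omega>)\<^sup>2)"
    and "expectation (\<lambda>\<omega>. (\<Sum>i\<in>I. X i \<omega>)\<^sup>2) = (\<Sum>i\<in>I. expectation (\<lambda>\<omega>. (X i \<omega>)\<^sup>2))"
proof -
  have prod: "integrable M (\<lambda>\<omega>. X i \<omega> * X j \<omega>) \<and>
      expectation (\<lambda>\<omega>. X i \<omega> * X j \<omega>) = (if i = j then expectation (\<lambda>\<omega>. (X i \<omega>)\<^sup>2) else 0)"
    if ij: "i \<in> I" "j \<in> I" for i j
  proof (cases "i = j")
    case True
    then show ?thesis using int(2)[OF ij(1)] by (simp add: power2_eq_square)
  next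
    case False
    have sub: "indep_vars (\<lambda>_. borel) X {i, j}" by (rule indep_vars_subset[OF indep]) (use ij in auto)
    have "expectation (\<lambda>\<omega>. \<Prod>l\<in>{i, j}. X l \<omega>) = (\<Prod>l\<in>{i, j}. expectation (X l))"
      by (rule indep_vars_lebesgue_integral[OF _ sub]) (use ij int in auto)
    moreover have "integrable M (\<lambda>\<omega>. \<Prod>l\<in>{i, j}. X l \<omega>)"
      by (rule indep_vars_integrable[OF _ sub]) (use ij int in auto)
    ultimately show ?thesis using False ij mean by simp
  qed
  have eq: "(\<Sum>i\<in>I. X i \<omega>)\<^sup>2 = (\<Sum>i\<in>I. \<Sum>j\<in>I. X i \<omega> * X j \<omega>)" for \<omega>
    by (simp add: power2_eq_square sum_product)
  show "integrable M (\<lambda>\<omega>. (\<Sum>i\<in>I. X i \<omega>)\<^sup>2)"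
    unfolding eq by (intro Bochner_Integration.integrable_sum) (use prod in blast)
  have "expectation (\<lambda>\<omega>. (\<Sum>i\<in>I. X i \<omega>)\<^sup>2) = (\<Sum>i\<in>I. \<Sum>j\<in>I. expectation (\<lambda>\<omega>. X i \<omega> * X j \<omega>))"
    unfolding eq using prod by (simp add: Bochner_Integration.integral_sum)
  also have "\<dots> = (\<Sum>i\<in>I. \<Sum>j\<in>I. if i = j then expectation (\<lambda>\<omega>. (X i \<omega>)\<^sup>2) else 0)"
    by (intro sum.cong refl) (use prod in blast)
  also have "\<dots> = (\<Sum>i\<in>I. expectation (\<lambda>\<omega>. (X i \<omega>)\<^sup>2))" using I by simp
  finally show "expectation (\<lambda>\<omega>. (\<Sum>i\<in>I. X i \<omega>)\<^sup>2) = (\<Sum>i\<in>I. expectation (\<lambda>\<omega>. (X i \<omega>)\<^sup>2))" .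
qed

text \<open>The canonical model of an i.i.d. family: a sample point is a whole array of errors, and
  the random variables are the coordinate projections.\<close>

abbreviation gauss_field :: "('i \<Rightarrow> real) measure" where
  "gauss_field \<equiv> Pi\<^sub>M UNIV (\<lambda>_. std_normal_distribution)"

section \<open>Marginals, independence and moments of the Gaussian field\<close>

lemma prob_space_std_normal: "prob_space std_normal_distribution"
  by (rule prob_space_normal_density) simp

lemma prob_space_gauss_field: "prob_space gauss_field"
  by (intro prob_space_PiM prob_space_std_normal)

lemma measurable_gauss_field_component[measurable]: "(\<lambda>\<omega>. \<omega> p) \<in> borel_measurable gauss_field"
proof -
  have "(\<lambda>\<omega>. \<omega> p) \<in> gauss_field \<rightarrow>\<^sub>M std_normal_distribution"
    by (rule measurable_component_singleton) simp
  then show ?thesis by simp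
qed

lemma distr_gauss_field_component: "distr gauss_field borel (\<lambda>\<omega>. \<omega> p) = std_normal_distribution"
proof -
  have "distr gauss_field std_normal_distribution (\<lambda>\<omega>. \<omega> p) = std_normal_distribution"
    by (rule distr_PiM_component) (auto intro: prob_space_std_normal)
  moreover have "distr gauss_field borel (\<lambda>\<omega>. \<omega> p) = distr gauss_field std_normal_distribution (\<lambda>\<omega>. \<omega> p)"
    by (rule distr_cong) auto
  ultimately show ?thesis by simp
qed

text \<open>Independence means that the joint law is the product of the marginals. The joint map is
  the identity here, so its law is the product measure itself.\<close>

lemma indep_vars_gauss_field: "prob_space.indep_vars gauss_field (\<lambda>_. borel) (\<lambda>p \<omega>. \<omega> p) UNIV"
proof (subst prob_space.indep_vars_iff_distr_eq_PiM'[OF prob_space_gauss_field])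
  \<comment> \<open>\<open>distr\<close> depends on its target only through the sigma-algebra, and
    both targets have the same one.\<close>
  have "distr gauss_field (Pi\<^sub>M UNIV (\<lambda>_. borel)) (\<lambda>\<omega>. \<omega>) = distr gauss_field gauss_field (\<lambda>\<omega>. \<omega>)"
    by (intro distr_cong refl sets_PiM_cong) auto
  then show "distr gauss_field (Pi\<^sub>M UNIV (\<lambda>_. borel)) (\<lambda>x. \<lambda>p\<in>UNIV. x p)
      = Pi\<^sub>M UNIV (\<lambda>p. distr gauss_field borel (\<lambda>\<omega>. \<omega> p))"
    by (simp add: distr_gauss_field_component distr_id restrict_UNIV)
qed auto

lemma gauss_field_moments:
  shows "integrable gauss_field (\<lambda>\<omega>. \<omega> p ^ k)"
    and "(LINT \<omega>|gauss_field. \<omega> p ^ k) = (LINT x|std_normal_distribution. x ^ k)"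
proof -
  have "integrable (distr gauss_field borel (\<lambda>\<omega>. \<omega> p)) (\<lambda>x. x ^ k)"
    unfolding distr_gauss_field_component by (rule integrable_std_normal_distribution_moment)
  then show "integrable gauss_field (\<lambda>\<omega>. \<omega> p ^ k)" by (simp add: integrable_distr_eq)
  have "(LINT \<omega>|gauss_field. \<omega> p ^ k) = (LINT x|distr gauss_field borel (\<lambda>\<omega>. \<omega> p). x ^ k)"
    by (simp add: integral_distr)
  then show "(LINT \<omega>|gauss_field. \<omega> p ^ k) = (LINT x|std_normal_distribution. x ^ k)"
    unfolding distr_gauss_field_component .
qed

lemma gauss_field_mean: "integrable gauss_field (\<lambda>\<omega>. \<omega> p)" "(LINT \<omega>|gauss_field. \<omega> p) = 0"
  using gauss_field_moments[of p 1] integral_std_normal_distribution_moment_odd[of 1] by auto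

lemma gauss_field_variance:
  "integrable gauss_field (\<lambda>\<omega>. (\<omega> p)\<^sup>2)" "(LINT \<omega>|gauss_field. (\<omega> p)\<^sup>2) = 1"
  using gauss_field_moments[of p 2] std_normal_distribution_even_moments(1)[of 1] by auto

lemma error_model_gauss_field: "error_model gauss_field (\<lambda>i j \<omega>. \<omega> (i, j))"
  unfolding error_model_def
  using indep_vars_gauss_field prob_space_gauss_field
  by (simp add: distr_gauss_field_component gauss_field_mean gauss_field_variance case_prod_unfold)

lemma gauss_field_sum_square:
  assumes "finite I"
  shows "integrable gauss_field (\<lambda>\<omega>. (\<Sum>p\<in>I. \<omega> p)\<^sup>2)"
    and "(LINT \<omega>|gauss_field. (\<Sum>p\<in>I. \<omega> p)\<^sup>2) = card I"
proof -
  interpret prob_space gauss_field by (rule prob_space_gauss_field)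
  have indep: "indep_vars (\<lambda>_. borel) (\<lambda>p \<omega>. \<omega> p) I"
    by (rule indep_vars_subset[OF indep_vars_gauss_field]) simp
  note * = expectation_square_sum_indep[OF assms indep]
  show "integrable gauss_field (\<lambda>\<omega>. (\<Sum>p\<in>I. \<omega> p)\<^sup>2)"
    by (rule *) (auto simp: gauss_field_mean gauss_field_variance)
  show "(LINT \<omega>|gauss_field. (\<Sum>p\<in>I. \<omega> p)\<^sup>2) = card I"
    by (subst *) (auto simp: gauss_field_mean gauss_field_variance)
qed

text \<open>Averaging \<open>m\<close> independent unit-variance errors gives variance
  \<open>m / m\<^sup>2\<close>. For \<open>m = 0\<close> both sides are 0, as division by zero
  yields 0.\<close>

lemma gauss_field_mean_square:
  fixes m j :: nat
  shows "integrable gauss_field (\<lambda>\<omega>. ((1 / m) * (\<Sum>i<m. \<omega> (i, j)))\<^sup>2)"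
    and "(LINT \<omega>|gauss_field. ((1 / m) * (\<Sum>i<m. \<omega> (i, j)))\<^sup>2) = 1 / m"
proof -
  \<comment> \<open>The sum over repetitions becomes a sum over a finite set of field indices, the
    form of \<open>gauss_field_sum_square\<close>.\<close>
  have sum: "(\<Sum>i<m. \<omega> (i, j)) = (\<Sum>p\<in>(\<lambda>i. (i, j)) ` {..<m}. \<omega> p)" for \<omega> :: "nat \<times> nat \<Rightarrow> real"
    by (simp add: sum.reindex inj_on_def)
  have card: "card ((\<lambda>i. (i, j)) ` {..<m}) = m"
    by (simp add: card_image inj_on_def)
  show "integrable gauss_field (\<lambda>\<omega>. ((1 / m) * (\<Sum>i<m. \<omega> (i, j)))\<^sup>2)"
    unfolding sum power_mult_distrib by (intro integrable_mult_right gauss_field_sum_square) simp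
  show "(LINT \<omega>|gauss_field. ((1 / m) * (\<Sum>i<m. \<omega> (i, j)))\<^sup>2) = 1 / m"
    unfolding sum power_mult_distrib by (simp add: gauss_field_sum_square card, simp add: power2_eq_square)
qed

section \<open>Divergence\<close>

text \<open>Nonnegativity allows dropping an initial segment, after which every term is large and at
  least half of the terms remain.\<close>

lemma filterlim_cesaro_at_top:
  fixes f :: "nat \<Rightarrow> real"
  assumes f: "filterlim f at_top sequentially" and nonneg: "\<And>n. 0 \<le> f n"
  shows "filterlim (\<lambda>m. (\<Sum>j<m. f j) / m) at_top sequentially"
  unfolding filterlim_at_top_gt[where c = 0]
proof (intro allI impI)
  fix C :: real assume C: "0 < C"
  obtain N where N: "\<And>n. n \<ge> N \<Longrightarrow> 2 * C \<le> f n"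
    using f unfolding filterlim_at_top eventually_sequentially by blast
  \<comment> \<open>From \<open>m \<ge> 2 * N\<close> follows \<open>2 * (m - N) \<ge> m\<close>,
    which the factor 2 in \<open>2 * C\<close> exploits; the extra 1 makes the divisor
    positive.\<close>
  have "C \<le> (\<Sum>j<m. f j) / m" if m: "m \<ge> 2 * N + 1" for m
  proof -
    have "C * m \<le> (m - N) * (2 * C)"
    proof -
      have "C * m \<le> C * (2 * (real m - real N))" using m C by (intro mult_left_mono) auto
      with m show ?thesis by (simp add: of_nat_diff algebra_simps)
    qed
    also have "\<dots> = (\<Sum>j\<in>{N..<m}. 2 * C)" by simp
    also have "\<dots> \<le> (\<Sum>j\<in>{N..<m}. f j)" by (intro sum_mono N) simp
    also have "\<dots> \<le> (\<Sum>j<m. f j)" by (intro sum_mono2) (auto simp: nonneg)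
    finally show ?thesis using m by (simp add: field_simps)
  qed
  then show "\<forall>\<^sub>F m in sequentially. C \<le> (\<Sum>j<m. f j) / m"
    unfolding eventually_sequentially by blast
qed

theorem proposition4p1:
  fixes \<alpha> :: "nat \<Rightarrow> real"
  assumes "\<And>m. 0 < \<alpha> m"
    and "decseq \<alpha>"
    and "\<alpha> \<longlonglongrightarrow> 0"
  shows "\<exists>(K :: ell2 \<Rightarrow> ell2) (y :: ell2) (P :: nat \<Rightarrow> ell2 \<Rightarrow> real Matrix.vec)
           (M :: (nat \<times> nat \<Rightarrow> real) measure) (\<delta> :: nat \<Rightarrow> nat \<Rightarrow> (nat \<times> nat \<Rightarrow> real) \<Rightarrow> real).
           compact_operator K \<and> y \<in> mp_domain K \<and> discretisation_scheme P \<and> error_model M \<delta> \<and>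
           filterlim
             (\<lambda>m. LINT \<omega>|M. (norm (tikhonov (\<lambda>x. P m (K x)) (\<alpha> m) (averaged_data P y \<delta> m m \<omega>)
                                   - mp_inverse K y))\<^sup>2)
             at_top sequentially"
proof -
  \<comment> \<open>With these singular values every sampled channel satisfies
    \<open>(k j)\<^sup>2 \<ge> \<alpha> m\<close>, so the filter factor is at least
    \<open>1 / (2 * k j)\<close>, half of the unregularised inverse: the noise is hardly
    damped.\<close>
  define k where "k n = sqrt (\<alpha> n)" for n
  have k2: "(k n)\<^sup>2 = \<alpha> n" and k_nonzero: "k n \<noteq> 0" for n
    using assms(1)[of n] by (auto simp: k_def)
  have k0: "k \<longlonglongrightarrow> 0"
    unfolding k_def using tendsto_real_sqrt[OF assms(3)] by simp
  then have Bk: "Bseq k" using convergentI convergent_imp_Bseq by blast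
  define K where "K = diag_ell2 k"
  define \<delta> where "\<delta> = (\<lambda>(i::nat) (j::nat) (\<omega> :: nat \<times> nat \<Rightarrow> real). \<omega> (i, j))"
  have lin: "linear K"
    unfolding K_def using bounded_linear_diag_ell2[OF Bk] by (rule bounded_linear.linear)
  have "inj K"
  proof (rule injI)
    fix x y assume "K x = K y"
    then have "coord (K x) n = coord (K y) n" for n by simp
    then show "x = y" by (intro ell2_eqI) (simp add: K_def coord_diag_ell2[OF Bk] k_nonzero)
  qed
  then have mp: "mp_inverse K 0 = 0" using lin by (intro mp_inverse_zero)
  have "0 = K 0 + 0" using lin by (simp add: linear_0)
  then have dom: "0 \<in> mp_domain K"
    unfolding mp_domain_def using subspace_0[OF subspace_orthogonal_comp[of "range K"]] by blast
  \<comment> \<open>As datum and exact solution both vanish, the error is pure propagated noise: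
    squared filter factors times the variance \<open>1 / m\<close> of each channel mean.\<close>
  have err: "(LINT \<omega>|gauss_field. (norm (tikhonov (\<lambda>x. sample_ell2 m (K x)) (\<alpha> m)
        (averaged_data sample_ell2 0 \<delta> m m \<omega>) - mp_inverse K 0))\<^sup>2)
      = (\<Sum>j<m. \<alpha> j / (\<alpha> j + \<alpha> m)\<^sup>2) / m" for m
  proof -
    let ?avg = "\<lambda>j (\<omega> :: nat \<times> nat \<Rightarrow> real). (1 / real m) * (\<Sum>i<m. \<omega> (i, j))"
    have A: "(\<lambda>x. sample_ell2 m (K x)) = (\<lambda>x. Matrix.vec m (\<lambda>j. k j * coord x j))"
      by (intro ext eq_vecI) (auto simp: sample_ell2_def K_def coord_diag_ell2[OF Bk])
    have avg: "vec_index (averaged_data sample_ell2 0 \<delta> m m \<omega>) j = ?avg j \<omega>" if "j < m" for j \<omega>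
      using that by (simp add: averaged_data_def measurement_def sample_ell2_def \<delta>_def zero_ell2.rep_eq)
    have dim: "averaged_data sample_ell2 0 \<delta> m m \<omega> \<in> carrier_vec m" for \<omega>
      by (simp add: averaged_data_def)
    have "(norm (tikhonov (\<lambda>x. sample_ell2 m (K x)) (\<alpha> m)
        (averaged_data sample_ell2 0 \<delta> m m \<omega>) - mp_inverse K 0))\<^sup>2
        = (\<Sum>j<m. \<alpha> j / (\<alpha> j + \<alpha> m)\<^sup>2 * (?avg j \<omega>)\<^sup>2)" for \<omega>
      unfolding A tikhonov_weighted[OF dim assms(1)] mp diff_0_right norm_unit_sum_sq
      by (intro sum.cong refl) (simp only: avg lessThan_iff power_mult_distrib power_divide k2)
    then have "(LINT \<omega>|gauss_field. (norm (tikhonov (\<lambda>x. sample_ell2 m (K x)) (\<alpha> m)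
        (averaged_data sample_ell2 0 \<delta> m m \<omega>) - mp_inverse K 0))\<^sup>2)
        = (LINT \<omega>|gauss_field. (\<Sum>j<m. \<alpha> j / (\<alpha> j + \<alpha> m)\<^sup>2 * (?avg j \<omega>)\<^sup>2))"
      by (simp only:)
    also have "\<dots> = (\<Sum>j<m. \<alpha> j / (\<alpha> j + \<alpha> m)\<^sup>2 * (LINT \<omega>|gauss_field. (?avg j \<omega>)\<^sup>2))"
      by (simp only: Bochner_Integration.integral_sum integrable_mult_right integral_mult_right_zero
        gauss_field_mean_square(1))
    also have "\<dots> = (\<Sum>j<m. \<alpha> j / (\<alpha> j + \<alpha> m)\<^sup>2) / m"
      unfolding gauss_field_mean_square(2) by (simp add: sum_divide_distrib)
    finally show ?thesis .
  qed
  \<comment> \<open>Monotonicity of \<open>\<alpha>\<close> bounds the denominator by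
    \<open>(2 * \<alpha> j)\<^sup>2\<close>, which makes the lower bound independent of
    \<open>m\<close> and the Cesaro argument applicable.\<close>
  have lower: "1 / (4 * \<alpha> j) \<le> \<alpha> j / (\<alpha> j + \<alpha> m)\<^sup>2" if "j < m" for j m
  proof -
    have "\<alpha> m \<le> \<alpha> j" using assms(2) that by (simp add: decseq_def)
    then have "(\<alpha> j + \<alpha> m)\<^sup>2 \<le> (2 * \<alpha> j)\<^sup>2"
      using assms(1)[of m] assms(1)[of j] by (intro power_mono) auto
    moreover have "0 < (\<alpha> j + \<alpha> m)\<^sup>2" using assms(1)[of m] assms(1)[of j] by simp
    ultimately show ?thesis using assms(1)[of j] by (simp add: field_simps power2_eq_square)
  qed
  have "filterlim (\<lambda>j. inverse (\<alpha> j)) at_top sequentially"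
    using assms by (intro filterlim_inverse_at_top) auto
  then have "filterlim (\<lambda>j. 1 / 4 * inverse (\<alpha> j)) at_top sequentially"
    by (intro filterlim_tendsto_pos_mult_at_top[OF tendsto_const]) auto
  then have "filterlim (\<lambda>j. 1 / (4 * \<alpha> j)) at_top sequentially"
    by (simp add: field_simps)
  then have "filterlim (\<lambda>m. (\<Sum>j<m. 1 / (4 * \<alpha> j)) / m) at_top sequentially"
    using assms(1) by (intro filterlim_cesaro_at_top) (auto simp: less_imp_le)
  then have "filterlim (\<lambda>m. (\<Sum>j<m. \<alpha> j / (\<alpha> j + \<alpha> m)\<^sup>2) / m) at_top sequentially"
    by (rule filterlim_at_top_mono) (auto intro!: always_eventually divide_right_mono sum_mono lower)
  then have "filterlim (\<lambda>m. LINT \<omega>|gauss_field. (norm (tikhonov (\<lambda>x. sample_ell2 m (K x)) (\<alpha> m)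
        (averaged_data sample_ell2 0 \<delta> m m \<omega>) - mp_inverse K 0))\<^sup>2) at_top sequentially"
    unfolding err .
  moreover have "compact_operator K" unfolding K_def using k0 by (rule compact_operator_diag_ell2)
  moreover have "error_model gauss_field \<delta>" unfolding \<delta>_def by (rule error_model_gauss_field)
  ultimately show ?thesis
    using dom discretisation_scheme_sample_ell2 by blast
qed

end
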